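(* As $K\to\infty$, $$\sum_{2\le k\le K}(|E_k|-2)_+\ge\frac14K+O(1).$$ Consequently the assertion $\sum_{2\le k\le K}(|E_k|-2)=o(K)$ is false.
   Context: $\tau(n)$ is the number of positive divisors of $n$. For $k\ge2$, $$E_k=\{\tau(k^2-j)-j:\ 1\le j\le 2k-2,\ \tau(k^2-j)\ge j\}.$$ $(x)_+=\max(x,0)$. *)

theory Defs
  imports Complex_Main "HOL-Library.Landau_Symbols"
begin

definition tau :: "nat \<Rightarrow> nat" where
  "tau n = card {d. d dvd n}"

text \<open>For \<open>k \<ge> 2\<close> and \<open>1 \<le> j \<le> 2 k - 2\<close> one has \<open>(k - 1)\<^sup>2 < k\<^sup>2 - j\<close>, so no
  truncation occurs in the subtractions on natural numbers below. Only \<open>k \<ge> 2\<close> is meaningful.\<close>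

definition E :: "nat \<Rightarrow> int set" where
  "E k = {int (tau (k\<^sup>2 - j)) - int j | j. 1 \<le> j \<and> j \<le> 2 * k - 2 \<and> tau (k\<^sup>2 - j) \<ge> j}"

definition pos_part :: "real \<Rightarrow> real" where
  "pos_part x = max x 0"

end

theory Submission
  imports Defs "HOL-Computational_Algebra.Primes"
begin

text \<open>
  The proof compares the elements of \<open>E k\<close> modulo 4.  For \<open>1 \<le> j \<le> 2 * k - 2\<close> the number
  \<open>k\<^sup>2 - j\<close> lies strictly between two consecutive squares, so it has an even number of divisors
  (\<open>even_tau_nonsquare\<close>).  Hence \<open>\<tau>(k\<^sup>2 - j) - j\<close> has the parity of \<open>j\<close>, and \<open>j = 1\<close>, \<open>j = 2\<close>
  contribute two different elements to \<open>E k\<close>.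

  If moreover \<open>k \<equiv> \<plusminus>3\<close> modulo 8, then \<open>k\<^sup>2 - 1\<close> is 8 times an odd number and \<open>k\<^sup>2 - 3\<close> is
  twice a number congruent to 3 modulo 4, which is not a square.  By multiplicativity of \<open>\<tau>\<close>
  (\<open>tau_mult_coprime\<close>), both numbers have a multiple of 4 as their number of divisors.  The
  elements coming from \<open>j = 1\<close> and \<open>j = 3\<close> are therefore congruent to 3 and 1 modulo 4, while the
  one coming from \<open>j = 2\<close> is even: \<open>E k\<close> has at least three elements.  These two residue classes
  together have density 1/4.  As no term \<open>\<bar>E k\<bar> - 2\<close> is negative, already the sum without positive
  parts is at least \<open>K / 4 - 3 / 4\<close>, and both claims follow.
\<close>

section \<open>Parity and multiplicativity of the divisor function\<close>

lemma finite_divisors: "0 < n \<Longrightarrow> finite {d::nat. d dvd n}"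
  by (rule finite_subset[of _ "{..n}"]) (auto dest: dvd_imp_le)

lemma tau_pos: "0 < n \<Longrightarrow> 0 < tau n"
  unfolding tau_def by (auto simp: card_gt_0_iff finite_divisors)

text \<open>The map \<open>d \<mapsto> n / d\<close> exchanges the divisors below \<open>\<surd>n\<close> with those above it,
  and no divisor equals \<open>\<surd>n\<close>.\<close>

lemma even_tau_nonsquare:
  assumes "0 < n" and nonsquare: "\<And>d. d * d \<noteq> n"
  shows "even (tau n)"
proof -
  let ?A = "{d. d dvd n \<and> d * d < n}" and ?B = "{d. d dvd n \<and> n < d * d}"
  have codivisor: "n div d dvd n" "n div (n div d) = d" "d * (n div d) = n" if "d dvd n" for d
    using that assms(1) by (auto elim!: dvdE)
  have small: "n div d * (n div d) < n" if "d dvd n" "n < d * d" for d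
  proof (rule ccontr)
    assume "\<not> ?thesis"
    then have "n * n < (d * d) * (n div d * (n div d))"
      using that assms(1) by (intro mult_less_le_imp_less) auto
    also have "\<dots> = (d * (n div d)) * (d * (n div d))" by (simp add: algebra_simps)
    finally show False using codivisor(3)[OF that(1)] by simp
  qed
  have large: "n < n div d * (n div d)" if "d dvd n" "d * d < n" for d
  proof (rule ccontr)
    assume "\<not> ?thesis"
    then have "(d * d) * (n div d * (n div d)) < n * n"
      using that assms(1) by (intro mult_less_le_imp_less) auto
    moreover have "(d * d) * (n div d * (n div d)) = (d * (n div d)) * (d * (n div d))"
      by (simp add: algebra_simps)
    ultimately show False using codivisor(3)[OF that(1)] by simp
  qed
  have "bij_betw (\<lambda>d. n div d) ?A ?B"
    by (rule bij_betw_byWitness[where f' = "\<lambda>d. n div d"])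
      (auto simp: codivisor small large)
  then have "card ?A = card ?B" by (rule bij_betw_same_card)
  moreover have "{d. d dvd n} = ?A \<union> ?B"
    using nonsquare by (auto simp: neq_iff)
  moreover have "card (?A \<union> ?B) = card ?A + card ?B"
    using finite_divisors[OF assms(1)] by (intro card_Un_disjoint) auto
  ultimately have "tau n = card ?B + card ?B" by (simp only: tau_def)
  then show ?thesis by simp
qed

text \<open>A divisor \<open>x\<close> of \<open>a * b\<close> splits uniquely as \<open>gcd x a * gcd x b\<close>.\<close>

lemma tau_mult_coprime:
  assumes "coprime a b"
  shows "tau (a * b) = tau a * tau b"
proof -
  have recover: "gcd (d * e) a = d" "gcd (d * e) b = e" if "d dvd a" "e dvd b" for d e
  proof -
    have "coprime e a" "coprime d b"
      using that assms by (meson coprime_commute coprime_divisors dvd_refl)+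
    then show "gcd (d * e) a = d" "gcd (d * e) b = e"
      using that by (simp_all add: gcd_mult_right_right_cancel gcd_mult_left_right_cancel
          gcd_mult_left_left_cancel gcd_proj1_iff coprime_commute)
  qed
  have "bij_betw (\<lambda>(d, e). d * e) ({d. d dvd a} \<times> {e. e dvd b}) {d. d dvd a * b}"
    unfolding bij_betw_def
  proof
    show "inj_on (\<lambda>(d, e). d * e) ({d. d dvd a} \<times> {e. e dvd b})"
      by (rule inj_on_inverseI[where g = "\<lambda>x. (gcd x a, gcd x b)"]) (auto simp: recover)
    show "(\<lambda>(d, e). d * e) ` ({d. d dvd a} \<times> {e. e dvd b}) = {d. d dvd a * b}"
    proof
      show "{d. d dvd a * b} \<subseteq> (\<lambda>(d, e). d * e) ` ({d. d dvd a} \<times> {e. e dvd b})"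
      proof
        fix x assume "x \<in> {d. d dvd a * b}"
        then obtain d e where "x = d * e" "d dvd a" "e dvd b"
          using division_decomp[of x a b] by auto
        then show "x \<in> (\<lambda>(d, e). d * e) ` ({d. d dvd a} \<times> {e. e dvd b})"
          by (intro image_eqI[of _ _ "(d, e)"]) simp_all
      qed
    qed (auto intro: mult_dvd_mono)
  qed
  from bij_betw_same_card[OF this] show ?thesis
    by (simp add: tau_def card_cartesian_product)
qed

lemma tau_two_power: "tau (2 ^ c) = Suc c"
proof -
  have "{d. d dvd (2::nat) ^ c} = (\<lambda>i. 2 ^ i) ` {..c}"
    using divides_primepow_nat[OF two_is_prime_nat] by auto
  then show ?thesis by (simp add: tau_def card_image inj_on_def)
qed

lemma tau_two_power_mult_odd: "odd m \<Longrightarrow> tau (2 ^ c * m) = Suc c * tau m"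
  by (simp add: tau_mult_coprime tau_two_power)

section \<open>Lower bounds for the size of E\<close>

lemma finite_E: "finite (E k)"
proof -
  have "E k \<subseteq> (\<lambda>j. int (tau (k\<^sup>2 - j)) - int j) ` {1..2 * k - 2}"
    by (auto simp: E_def)
  then show ?thesis by (rule finite_subset) simp
qed

lemma in_E:
  "1 \<le> j \<Longrightarrow> j \<le> 2 * k - 2 \<Longrightarrow> j \<le> tau (k\<^sup>2 - j) \<Longrightarrow> int (tau (k\<^sup>2 - j)) - int j \<in> E k"
  unfolding E_def by blast

text \<open>The range of \<open>j\<close> in \<open>E k\<close> is the one for which \<open>(k - 1)\<^sup>2 < k\<^sup>2 - j < k\<^sup>2\<close>.\<close>

lemma between_squares_nonsquare:
  fixes k j d :: nat
  assumes "1 \<le> j" "j \<le> 2 * k - 2"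
  shows "d * d \<noteq> k\<^sup>2 - j"
proof
  assume eq: "d * d = k\<^sup>2 - j"
  obtain k' where k: "k = Suc k'" using assms by (cases k) auto
  have "d * d < k * k" "k' * k' < d * d"
    using assms eq by (auto simp: k power2_eq_square)
  then have "d < k" "k' < d"
    by (meson linorder_not_less mult_le_mono)+
  then show False using k by simp
qed

lemma even_tau_in_range:
  assumes "1 \<le> j" "j \<le> 2 * k - 2"
  shows "even (tau (k\<^sup>2 - j))" and "0 < tau (k\<^sup>2 - j)"
proof -
  obtain k' where k: "k = Suc k'" using assms by (cases k) auto
  have "0 < k\<^sup>2 - j"
    using assms by (simp add: k power2_eq_square)
  then show "even (tau (k\<^sup>2 - j))" "0 < tau (k\<^sup>2 - j)"
    using between_squares_nonsquare[OF assms] even_tau_nonsquare tau_pos by auto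
qed

lemma elements_E_one_two:
  assumes "2 \<le> k"
  shows "int (tau (k\<^sup>2 - 1)) - 1 \<in> E k" "int (tau (k\<^sup>2 - 2)) - 2 \<in> E k"
proof -
  have "0 < tau (k\<^sup>2 - 1)" "even (tau (k\<^sup>2 - 2))" "0 < tau (k\<^sup>2 - 2)"
    using even_tau_in_range[of 1 k] even_tau_in_range[of 2 k] assms by simp_all
  then have "1 \<le> tau (k\<^sup>2 - 1)" "2 \<le> tau (k\<^sup>2 - 2)"
    by (auto dest: dvd_imp_le)
  then show "int (tau (k\<^sup>2 - 1)) - 1 \<in> E k" "int (tau (k\<^sup>2 - 2)) - 2 \<in> E k"
    using in_E[of 1 k] in_E[of 2 k] assms by auto
qed

lemma card_E_ge_2:
  assumes "2 \<le> k"
  shows "2 \<le> card (E k)"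
proof -
  let ?x = "int (tau (k\<^sup>2 - 1)) - 1" and ?y = "int (tau (k\<^sup>2 - 2)) - 2"
  have "even (tau (k\<^sup>2 - 1))" "even (tau (k\<^sup>2 - 2))"
    using even_tau_in_range[of 1 k] even_tau_in_range[of 2 k] assms by simp_all
  then have "odd ?x" "even ?y" by auto
  then have "?x \<noteq> ?y" by metis
  then have "card {?x, ?y} = 2" by simp
  moreover have "card {?x, ?y} \<le> card (E k)"
    using elements_E_one_two[OF assms] by (intro card_mono finite_E) auto
  ultimately show ?thesis by simp
qed

lemma four_dvd_tau_eight_mult_odd: "odd m \<Longrightarrow> 4 dvd tau (8 * m)"
  using tau_two_power_mult_odd[of m 3] by simp

text \<open>The odd part is 3 modulo 4, hence no square, and contributes a second factor 2.\<close>

lemma four_dvd_tau_two_mult_3_mod_4: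
  assumes "m mod 4 = 3"
  shows "4 dvd tau (2 * m)"
proof -
  have "d * d \<noteq> m" for d
  proof
    assume "d * d = m"
    then have "(d mod 4) * (d mod 4) mod 4 = 3" using assms by (simp add: mod_mult_eq)
    moreover have "d mod 4 \<in> {0, 1, 2, 3}" by auto
    ultimately show False by auto
  qed
  moreover have "odd m" "0 < m" using assms by presburger+
  ultimately have "even (tau m)" by (auto intro: even_tau_nonsquare)
  then show ?thesis using tau_two_power_mult_odd[OF \<open>odd m\<close>, of 1] by auto
qed

text \<open>Divisibility of \<open>\<tau>(k\<^sup>2 - 3)\<close> by 4 is used twice: it gives \<open>\<tau>(k\<^sup>2 - 3) \<ge> 3\<close>, so that
  \<open>j = 3\<close> contributes to \<open>E k\<close>, and it separates this contribution from that of \<open>j = 1\<close>, which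
  has the same parity.\<close>

lemma card_E_ge_3:
  assumes "k mod 8 = 3 \<or> k mod 8 = 5"
  shows "3 \<le> card (E k)"
proof -
  have k: "3 \<le> k" using assms by presburger
  \<comment> \<open>Modulo 16 is needed to see that \<open>k\<^sup>2 - 1\<close> is exactly divisible by 8.\<close>
  have "k mod 16 \<in> {3, 5, 11, 13}" using assms by simp presburger
  then have "(k mod 16)\<^sup>2 mod 16 = 9" by auto
  then have k2: "k\<^sup>2 mod 16 = 9" by (simp add: power_mod)
  obtain c where c: "k\<^sup>2 = 16 * c + 9"
    using k2 by (metis mult_div_mod_eq)
  have "k\<^sup>2 - 1 = 8 * (2 * c + 1)" "k\<^sup>2 - 3 = 2 * (8 * c + 3)"
    by (simp_all add: c)
  moreover have "(8 * c + 3) mod 4 = 3"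
    by presburger
  ultimately have t1: "4 dvd tau (k\<^sup>2 - 1)" and t3: "4 dvd tau (k\<^sup>2 - 3)"
    using four_dvd_tau_eight_mult_odd[of "2 * c + 1"] four_dvd_tau_two_mult_3_mod_4[of "8 * c + 3"]
    by simp_all
  have t2: "even (tau (k\<^sup>2 - 2))"
    using even_tau_in_range[of 2 k] k by simp
  let ?x = "int (tau (k\<^sup>2 - 1)) - 1" and ?y = "int (tau (k\<^sup>2 - 2)) - 2"
    and ?z = "int (tau (k\<^sup>2 - 3)) - 3"
  have "0 < tau (k\<^sup>2 - 3)" using even_tau_in_range[of 3 k] k by simp
  then have "4 \<le> tau (k\<^sup>2 - 3)" using t3 by (auto dest: dvd_imp_le)
  then have "?z \<in> E k"
    using in_E[of 3 k] k by auto
  then have "card {?x, ?y, ?z} \<le> card (E k)"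
    using elements_E_one_two[of k] k by (intro card_mono finite_E) auto
  moreover have "?x \<noteq> ?y" "?y \<noteq> ?z" "?x \<noteq> ?z"
    using t1 t2 t3 by presburger+
  then have "card {?x, ?y, ?z} = 3" by simp
  ultimately show ?thesis by simp
qed

section \<open>Summation\<close>

text \<open>The first quotient counts the \<open>k \<le> K\<close> with residue 3, the second those with residue 5;
  the inductive step only has to see which quotient jumps.\<close>

lemma sum_residues_3_5_mod_8:
  "(\<Sum>k = 2..K. if k mod 8 = 3 \<or> k mod 8 = 5 then 1 else 0) = (K + 5 :: nat) div 8 + (K + 3) div 8"
proof (induction K)
  case (Suc K)
  define q r where "q = K div 8" and "r = K mod 8"
  have K: "K = 8 * q + r" "r \<in> {0, 1, 2, 3, 4, 5, 6, 7}"
    unfolding q_def r_def by auto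
  have "(Suc K + 5) div 8 = (K + 5) div 8 + (if Suc K mod 8 = 3 then 1 else 0)"
    "(Suc K + 3) div 8 = (K + 3) div 8 + (if Suc K mod 8 = 5 then 1 else 0)"
    using K(2) by (auto simp: K(1) mod_Suc)
  then show ?case
    using Suc.IH by (cases "K = 0") auto
qed simp

lemma sum_card_E_lower_bound:
  "1 / 4 * real K - 3 / 4 \<le> (\<Sum>k = 2..K. (real (card (E k)) - 2))"
proof -
  have "K \<le> 4 * ((K + 5) div 8 + (K + 3) div 8) + 3"
    using dividend_less_times_div[of 8 "K + 5"] dividend_less_times_div[of 8 "K + 3"] by simp
  then have "real K \<le> real (4 * ((K + 5) div 8 + (K + 3) div 8) + 3)"
    by (rule of_nat_mono)
  then have "1 / 4 * real K - 3 / 4 \<le> real ((K + 5) div 8 + (K + 3) div 8)"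
    by simp
  also have "\<dots> = (\<Sum>k = 2..K. real (if k mod 8 = 3 \<or> k mod 8 = 5 then 1 else 0))"
    by (simp only: sum_residues_3_5_mod_8[symmetric] of_nat_sum)
  also have "\<dots> \<le> (\<Sum>k = 2..K. (real (card (E k)) - 2))"
  proof (rule sum_mono)
    fix k assume "k \<in> {2..K}"
    then show "real (if k mod 8 = 3 \<or> k mod 8 = 5 then 1 else 0) \<le> real (card (E k)) - 2"
      using card_E_ge_2[of k] card_E_ge_3[of k] by auto
  qed
  finally show ?thesis .
qed

theorem corollary7p6:
  shows "(\<exists>r :: nat \<Rightarrow> real. r \<in> O[sequentially](\<lambda>_. 1) \<and>
           (\<forall>\<^sub>F K in sequentially.
              (\<Sum>k = 2..K. pos_part (real (card (E k)) - 2)) \<ge> 1 / 4 * real K + r K)) \<and>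
         (\<lambda>K :: nat. \<Sum>k = 2..K. (real (card (E k)) - 2)) \<notin> o[sequentially](\<lambda>K. real K)"
proof (intro conjI exI[of _ "\<lambda>_. - 3 / 4"])
  show "(\<lambda>_. - 3 / 4) \<in> O[sequentially](\<lambda>_. 1 :: real)" by simp
  have "1 / 4 * real K + (- 3 / 4) \<le> (\<Sum>k = 2..K. pos_part (real (card (E k)) - 2))" for K
  proof -
    have "(\<Sum>k = 2..K. (real (card (E k)) - 2)) \<le> (\<Sum>k = 2..K. pos_part (real (card (E k)) - 2))"
      by (intro sum_mono) (simp add: pos_part_def)
    then show ?thesis using sum_card_E_lower_bound[of K] by simp
  qed
  then show "\<forall>\<^sub>F K in sequentially.
      1 / 4 * real K + - 3 / 4 \<le> (\<Sum>k = 2..K. pos_part (real (card (E k)) - 2))"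
    by simp
  show "(\<lambda>K :: nat. \<Sum>k = 2..K. (real (card (E k)) - 2)) \<notin> o[sequentially](\<lambda>K. real K)"
  proof
    assume "(\<lambda>K :: nat. \<Sum>k = 2..K. (real (card (E k)) - 2)) \<in> o[sequentially](\<lambda>K. real K)"
    from landau_o.smallD[OF this, of "1 / 8"]
    have "\<forall>\<^sub>F K in sequentially. \<bar>\<Sum>k = 2..K. (real (card (E k)) - 2)\<bar> \<le> 1 / 8 * real K"
      by simp
    moreover have "\<forall>\<^sub>F K in sequentially. 6 < (K::nat)"
      by (rule eventually_gt_at_top)
    ultimately have "\<forall>\<^sub>F K :: nat in sequentially. False"
    proof eventually_elim
      case (elim K)
      then show False using sum_card_E_lower_bound[of K] by linarith
    qed
    then show False by simp
  qed
qed

end
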